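(* Let $S^\pm(z)=S_1^\pm(z)-S_2^\pm(z)$ be the screening currents defined in the context, written in terms of the Heisenberg algebra $\mathcal H$ through the realization given there, with $q_1=e^\hbar$, $q_2=e^{(\beta-1)\hbar}$, $q_3=e^{-\beta\hbar}$ and $\beta$ fixed. Then $$\lim_{\hbar\to0}S^\pm(z)=\frac{\sqrt{-2}}{t_\pm}\,\mathsf S^\pm(z),$$ where $\mathsf S^\pm(z)=t_\pm\,\psi(z):e^{t_\pm\widetilde\phi(z)}:$ are the screening currents of the $N=1$ super Virasoro algebra with $\sigma=\dfrac{1-\beta}{2\sqrt\beta}$, and the parameters $t_\pm$ (formally $t_\pm=\sigma\pm\sqrt{\sigma^2+1}$) are assigned as $t_+=\dfrac1{\sqrt\beta}$, $t_-=-\sqrt\beta$.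
   Context: Heisenberg algebra $\mathcal H$: generators $a_n,Q,\widetilde a_n,\widetilde Q$ ($n\in\mathbb Z$) with $[a_n,a_m]=[\widetilde a_n,\widetilde a_m]=n\delta_{n+m,0}$, $[a_n,\widetilde a_m]=0$, $[a_n,Q]=[\widetilde a_n,\widetilde Q]=\delta_{n,0}$, $[a_n,\widetilde Q]=[\widetilde a_n,Q]=0$. $:\ast:$ is the usual normal ordering (modes with $n<0$ and $Q,\widetilde Q$ to the left, modes with $n\ge0$ to the right). $\phi(z)=Q+a_0\log z-\sum_{n\ne0}\frac1na_nz^{-n}$, $\widetilde\phi(z)=\widetilde Q+\widetilde a_0\log z-\sum_{n\ne0}\frac1n\widetilde a_nz^{-n}$, $\psi(z)=\frac1{\sqrt{-2}}(:e^{\phi(z)}:-:e^{-\phi(z)}:)$. The super Virasoro currents in this realization are built from $\widetilde\phi$ and $\psi$ with parameter $\sigma$, e.g. $G(z)=:\widetilde\phi'(z):\psi(z)+2\sigma\psi'(z)$. Screening currents: $q=e^{(\beta-1)\hbar/2}$ (fractional powers of $q_1,q_3$ are taken via $\hbar$), $\tau_+=1/\beta$, $\tau_-=-1$, $s_+=q_3$, $s_-=q_1$. With $\gamma^\pm_n=\dfrac{s_\pm^{n/2}(1+q_2^n)}{n\,q^n(1-s_\pm^{2n})}$, $$S_1^\pm(z)=\exp\Big(\sum_{n>0}\gamma_n^\pm(h^\perp_{1,-n}+s_\pm^nh^\perp_{2,-n})z^n\Big)\exp\Big(\sum_{n>0}\gamma_n^\pm(s_\pm^nh^\perp_{1,n}+h^\perp_{2,n})z^{-n}\Big)e^{Q_1^\perp+\tau_\pm\mathsf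 Q^\perp}z^{h^\perp_{1,0}+2\tau_\pm\mathsf a_0^\perp},$$ $$S_2^\pm(z)=\exp\Big(\sum_{n>0}\gamma_n^\pm(s_\pm^nh^\perp_{1,-n}+h^\perp_{2,-n})z^n\Big)\exp\Big(\sum_{n>0}\gamma_n^\pm(h^\perp_{1,n}+s_\pm^nh^\perp_{2,n})z^{-n}\Big)e^{-Q_1^\perp+\tau_\pm\mathsf Q^\perp}z^{-h^\perp_{1,0}+2\tau_\pm\mathsf a_0^\perp}.$$ Realization in $\mathcal H$ (for $n>0$): $$h^\perp_{1,n}=\tfrac{(1+q_1^n)(1+q_3^n)}{2(1+q_2^{-n})}a_n+\tfrac{\sqrt\beta}2(1-q_1^n)\widetilde a_n,\quad h^\perp_{1,-n}=a_{-n}+\tfrac{1-q_3^n}{\sqrt\beta(1+q_2^{-n})}\widetilde a_{-n},$$ $$h^\perp_{2,n}=-\tfrac{(1+q_1^n)(1+q_3^n)}{2(1+q_2^{-n})}a_n+\tfrac{\sqrt\beta}2(1-q_1^n)\widetilde a_n,\quad h^\perp_{2,-n}=-a_{-n}+\tfrac{1-q_3^n}{\sqrt\beta(1+q_2^{-n})}\widetilde a_{-n},$$ $h^\perp_{1,0}=-h^\perp_{2,0}=a_0$, $Q_1^\perp=-Q_2^\perp=Q$, $\mathsf a_0^\perp=\frac{\sqrt\beta}2\widetilde a_0$, $\mathsf Q^\perp=\sqrt\beta\,\widetilde Q$. The limit $\hbar\to0$ ($\beta$ fixed) is taken in the normally ordered expressions in the generators of $\mathcal H$. *)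

theory Defs
  imports
    "HOL-Analysis.Analysis"
    "HOL-Library.Multiset"
    "HOL-Library.Function_Algebras"
begin

section \<open>The Heisenberg algebra\<close>

text \<open>
  \<open>Mode Phi n\<close>, \<open>ZeroQ Phi\<close> are \<open>a_n\<close>, \<open>Q\<close>; \<open>Mode PhiT n\<close>, \<open>ZeroQ PhiT\<close> are the
  generators with a tilde.
\<close>

datatype boson = Phi | PhiT

datatype gen = Mode boson int | ZeroQ boson

fun comm :: "gen \<Rightarrow> gen \<Rightarrow> complex" where
  "comm (Mode b n) (Mode b' m) = (if b = b' \<and> n + m = 0 then of_int n else 0)"
| "comm (Mode b n) (ZeroQ b') = (if b = b' \<and> n = 0 then 1 else 0)"
| "comm (ZeroQ b) (Mode b' n) = (if b = b' \<and> n = 0 then - 1 else 0)"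
| "comm (ZeroQ b) (ZeroQ b') = 0"

text \<open>
  In a normally ordered monomial the generators with \<open>is_ann\<close> stand to the right of the
  others.  The partner of such a generator is the only one on the left that it fails to
  commute with.
\<close>

fun is_ann :: "gen \<Rightarrow> bool" where
  "is_ann (Mode b n) \<longleftrightarrow> n \<ge> 0"
| "is_ann (ZeroQ b) \<longleftrightarrow> False"

fun partner :: "gen \<Rightarrow> gen" where
  "partner (Mode b n) = (if n = 0 then ZeroQ b else Mode b (- n))"
| "partner (ZeroQ b) = Mode b 0"

text \<open>
  Generators standing on the same side commute, so a normally ordered monomial is a multiset
  of generators.  An element of the completed algebra is a formal, possibly infinite, linear
  combination of normally ordered monomials and is identified with its coefficient function.
  Sums and differences are the pointwise ones of \<^theory>\<open>HOL-Library.Function_Algebras\<close>; the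
  pointwise product of that theory plays no role.
\<close>

type_synonym nser = "gen multiset \<Rightarrow> complex"

definition monom :: "gen multiset \<Rightarrow> nser" where
  "monom m = (\<lambda>m'. if m' = m then 1 else 0)"

abbreviation gen :: "gen \<Rightarrow> nser" where
  "gen x \<equiv> monom {#x#}"

definition scal :: "complex \<Rightarrow> nser \<Rightarrow> nser"  (infixr "\<bullet>\<^sub>s" 75) where
  "c \<bullet>\<^sub>s F = (\<lambda>m. c * F m)"

definition fsum :: "'i set \<Rightarrow> ('i \<Rightarrow> nser) \<Rightarrow> nser" where
  "fsum I F = (\<lambda>m. \<Sum>\<^sub>\<infinity>i\<in>I. F i m)"

text \<open>The normally ordered product \<open>:F G:\<close>, which is commutative.\<close>

definition nprod :: "nser \<Rightarrow> nser \<Rightarrow> nser" where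
  "nprod F G = (\<lambda>m. \<Sum>m1 | m1 \<subseteq># m. F m1 * G (m - m1))"

text \<open>
  The product of the algebra, by Wick's theorem: \<open>F G\<close> is the sum over all multisets \<open>k\<close> of
  contractions of an annihilator \<open>x\<close> in \<open>F\<close> with \<open>partner x\<close> in \<open>G\<close>.  In monomials containing
  \<open>x\<close> with multiplicity \<open>p\<close> and \<open>partner x\<close> with multiplicity \<open>r\<close>, there are
  \<open>j! (p choose j) (r choose j)\<close> ways to choose \<open>j\<close> such contractions, each contributing the
  commutator.  The commutation relations are recovered in \<open>gen_commutator\<close> below.
\<close>

definition wick_weight :: "gen multiset \<Rightarrow> gen multiset \<Rightarrow> gen multiset \<Rightarrow> complex" where
  "wick_weight k m1 m2 =
     (\<Prod>x\<in>set_mset k. comm x (partner x) ^ count k x * fact (count k x)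
        * of_nat (count m1 x choose count k x)
        * of_nat (count m2 (partner x) choose count k x))"

definition hprod :: "nser \<Rightarrow> nser \<Rightarrow> nser"  (infixl "\<star>" 70) where
  "F \<star> G = (\<lambda>m. \<Sum>\<^sub>\<infinity>k\<in>{k. \<forall>x\<in>#k. is_ann x}. \<Sum>m1 | m1 \<subseteq># m.
     (let M1 = m1 + k; M2 = (m - m1) + image_mset partner k
      in wick_weight k M1 M2 * F M1 * G M2))"

primrec hpow :: "nser \<Rightarrow> nat \<Rightarrow> nser" where
  "hpow F 0 = monom {#}"
| "hpow F (Suc k) = F \<star> hpow F k"

primrec npow :: "nser \<Rightarrow> nat \<Rightarrow> nser" where
  "npow F 0 = monom {#}"
| "npow F (Suc k) = nprod F (npow F k)"

text \<open>\<open>hexp F\<close> is \<open>e^F\<close> and \<open>nexp F\<close> is \<open>:e^F:\<close>.\<close>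

definition hexp :: "nser \<Rightarrow> nser" where
  "hexp F = fsum UNIV (\<lambda>k. (1 / fact k) \<bullet>\<^sub>s hpow F k)"

definition nexp :: "nser \<Rightarrow> nser" where
  "nexp F = fsum UNIV (\<lambda>k. (1 / fact k) \<bullet>\<^sub>s npow F k)"

subsection \<open>The commutation relations\<close>

lemma finite_submultisets: "finite {m1. m1 \<subseteq># m}"
proof (induction m)
  case (add x m)
  have "m1 \<in> {m1. m1 \<subseteq># m} \<union> add_mset x ` {m1. m1 \<subseteq># m}"
    if "m1 \<subseteq># add_mset x m" for m1
  proof (cases "x \<in># m1")
    case True
    then obtain m' where "m1 = add_mset x m'" by (metis insert_DiffM)
    then show ?thesis using that by auto
  next
    case False
    then have "m1 \<subseteq># m"
      using that by (metis add_mset_remove_trivial diff_single_trivial subset_eq_diff_conv add_mset_add_single)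
    then show ?thesis by simp
  qed
  then have "{m1. m1 \<subseteq># add_mset x m} \<subseteq> {m1. m1 \<subseteq># m} \<union> add_mset x ` {m1. m1 \<subseteq># m}"
    by blast
  then show ?case using add.IH by (meson finite_UnI finite_imageI finite_subset)
qed simp

lemma gen_hprod:
  "(gen x \<star> F) m = (if x \<in># m then F (m - {#x#}) else 0)
     + (if is_ann x then comm x (partner x) * of_nat (Suc (count m (partner x)))
          * F (m + {#partner x#}) else 0)"
proof -
  let ?t = "\<lambda>k m1. let M1 = m1 + k; M2 = (m - m1) + image_mset partner k
      in wick_weight k M1 M2 * gen x M1 * F M2"
  let ?S = "\<lambda>k. \<Sum>m1 | m1 \<subseteq># m. ?t k m1"
  let ?K = "{k. \<forall>x\<in>#k. is_ann x}"
  have fin: "finite {m1. m1 \<subseteq># m}"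
    by (rule finite_submultisets)
  have S0: "?S {#} = (if x \<in># m then F (m - {#x#}) else 0)"
  proof -
    have "?S {#} = (\<Sum>m1 | m1 \<subseteq># m. if {#x#} = m1 then F (m - {#x#}) else 0)"
      by (rule sum.cong) (auto simp: wick_weight_def monom_def)
    then show ?thesis using fin by (simp add: sum.delta)
  qed
  have Sx: "?S {#x#} = comm x (partner x) * of_nat (Suc (count m (partner x)))
          * F (m + {#partner x#})"
  proof -
    have "?S {#x#} = (\<Sum>m1 | m1 \<subseteq># m. if {#} = m1 then
        comm x (partner x) * of_nat (Suc (count m (partner x))) * F (m + {#partner x#}) else 0)"
      by (rule sum.cong) (auto simp: wick_weight_def monom_def)
    then show ?thesis using fin by (simp add: sum.delta)
  qed
  have Sk: "?S k = 0" if "k \<noteq> {#}" "k \<noteq> {#x#}" for k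
  proof -
    have "m1 + k \<noteq> {#x#}" for m1
      using that by (auto simp: union_is_single)
    then show ?thesis by (simp add: monom_def Let_def)
  qed
  have "(gen x \<star> F) m = (\<Sum>\<^sub>\<infinity>k\<in>?K. ?S k)"
    by (simp add: hprod_def)
  also have "\<dots> = (\<Sum>\<^sub>\<infinity>k\<in>?K \<inter> {{#}, {#x#}}. ?S k)"
    by (rule infsum_cong_neutral) (use Sk in auto)
  also have "\<dots> = sum ?S (?K \<inter> {{#}, {#x#}})"
    by (rule infsum_finite) auto
  also have "?K \<inter> {{#}, {#x#}} = (if is_ann x then {{#}, {#x#}} else {{#}})"
    by auto
  also have "sum f \<dots> = f {#} + (if is_ann x then f {#x#} else 0)"
    for f :: "gen multiset \<Rightarrow> complex"
    by simp
  finally show ?thesis unfolding S0 Sx .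
qed

lemma gen_commutator: "gen x \<star> gen y - gen y \<star> gen x = comm x y \<bullet>\<^sub>s monom {#}"
proof
  fix m :: "gen multiset"
  have eq1: "m - {#a#} = {#b#} \<longleftrightarrow> m = {#a, b#}" if "a \<in># m" for a b
    using that by (metis add_mset_remove_trivial insert_DiffM)
  have eq2: "m + {#a#} = {#b#} \<longleftrightarrow> m = {#} \<and> a = b" for a b
    by (cases m) auto
  have prod: "(gen a \<star> gen b) m = (if m = {#a, b#} then 1 else 0)
     + (if is_ann a \<and> partner a = b \<and> m = {#} then comm a b else 0)" for a b
    unfolding gen_hprod by (auto simp: monom_def eq1 eq2)
  have sym: "{#x, y#} = {#y, x#}"
    by (rule add_mset_commute)
  have "(if is_ann x \<and> partner x = y then comm x y else 0)
     - (if is_ann y \<and> partner y = x then comm y x else 0) = comm x y"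
    by (cases x; cases y) auto
  moreover have "(gen x \<star> gen y - gen y \<star> gen x) m
     = (if m = {#} then (if is_ann x \<and> partner x = y then comm x y else 0)
     - (if is_ann y \<and> partner y = x then comm y x else 0) else 0)"
    unfolding fun_diff_def prod sym by simp
  ultimately show "(gen x \<star> gen y - gen y \<star> gen x) m = (comm x y \<bullet>\<^sub>s monom {#}) m"
    by (simp add: scal_def monom_def)
qed

section \<open>Super Virasoro currents\<close>

text \<open>
  \<open>l\<close> is the value of \<open>log z\<close>.  The coefficient of a normally ordered monomial in any current
  below is a constant times a single product of a power of \<open>z\<close> and a power of \<open>log z\<close>.
\<close>

definition boson_field :: "boson \<Rightarrow> complex \<Rightarrow> complex \<Rightarrow> nser" where
  "boson_field b z l = gen (ZeroQ b) + l \<bullet>\<^sub>s gen (Mode b 0)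
     - fsum (- {0}) (\<lambda>n::int. (z powi (- n) / of_int n) \<bullet>\<^sub>s gen (Mode b n))"

text \<open>The parameter \<open>w\<close> is a square root of \<open>-2\<close>.\<close>

definition psi :: "complex \<Rightarrow> complex \<Rightarrow> complex \<Rightarrow> nser" where
  "psi w z l = (1 / w) \<bullet>\<^sub>s
     (nexp (boson_field Phi z l) - nexp ((- 1) \<bullet>\<^sub>s boson_field Phi z l))"

definition super_screening :: "complex \<Rightarrow> complex \<Rightarrow> complex \<Rightarrow> complex \<Rightarrow> nser" where
  "super_screening w t z l = t \<bullet>\<^sub>s (psi w z l \<star> nexp (t \<bullet>\<^sub>s boson_field PhiT z l))"

datatype sgn = Plus | Minus

text \<open>In the sequel \<open>r\<close> is a square root of \<open>\<beta>\<close>.\<close>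

definition sigma_par :: "complex \<Rightarrow> complex \<Rightarrow> complex" where
  "sigma_par \<beta> r = (1 - \<beta>) / (2 * r)"

fun t_par :: "sgn \<Rightarrow> complex \<Rightarrow> complex" where
  "t_par Plus r = 1 / r"
| "t_par Minus r = - r"

section \<open>Deformed screening currents\<close>

definition q1 :: "complex \<Rightarrow> complex" where
  "q1 h = exp h"

definition q2 :: "complex \<Rightarrow> complex \<Rightarrow> complex" where
  "q2 \<beta> h = exp ((\<beta> - 1) * h)"

definition q3 :: "complex \<Rightarrow> complex \<Rightarrow> complex" where
  "q3 \<beta> h = exp (- \<beta> * h)"

definition q0 :: "complex \<Rightarrow> complex \<Rightarrow> complex" where
  "q0 \<beta> h = exp ((\<beta> - 1) * h / 2)"

fun tau :: "sgn \<Rightarrow> complex \<Rightarrow> complex" where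
  "tau Plus \<beta> = 1 / \<beta>"
| "tau Minus \<beta> = - 1"

fun s_par :: "sgn \<Rightarrow> complex \<Rightarrow> complex \<Rightarrow> complex" where
  "s_par Plus \<beta> h = q3 \<beta> h"
| "s_par Minus \<beta> h = q1 h"

text \<open>The square root of \<open>s_par\<close>, taken via \<open>h\<close>.\<close>

fun s_half :: "sgn \<Rightarrow> complex \<Rightarrow> complex \<Rightarrow> complex" where
  "s_half Plus \<beta> h = exp (- \<beta> * h / 2)"
| "s_half Minus \<beta> h = exp (h / 2)"

definition gamma_coeff :: "sgn \<Rightarrow> complex \<Rightarrow> complex \<Rightarrow> int \<Rightarrow> complex" where
  "gamma_coeff e \<beta> h n = s_half e \<beta> h powi n * (1 + q2 \<beta> h powi n)
     / (of_int n * q0 \<beta> h powi n * (1 - s_par e \<beta> h powi (2 * n)))"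

text \<open>For \<open>n < 0\<close> the formula given for the mode \<open>-k\<close> is used with \<open>k = -n\<close>.\<close>

definition h1 :: "complex \<Rightarrow> complex \<Rightarrow> complex \<Rightarrow> int \<Rightarrow> nser" where
  "h1 \<beta> r h n =
    (if n > 0 then
       ((1 + q1 h powi n) * (1 + q3 \<beta> h powi n) / (2 * (1 + q2 \<beta> h powi (- n))))
          \<bullet>\<^sub>s gen (Mode Phi n)
       + (r / 2 * (1 - q1 h powi n)) \<bullet>\<^sub>s gen (Mode PhiT n)
     else if n < 0 then
       gen (Mode Phi n)
       + ((1 - q3 \<beta> h powi (- n)) / (r * (1 + q2 \<beta> h powi n))) \<bullet>\<^sub>s gen (Mode PhiT n)
     else gen (Mode Phi 0))"

definition h2 :: "complex \<Rightarrow> complex \<Rightarrow> complex \<Rightarrow> int \<Rightarrow> nser" where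
  "h2 \<beta> r h n =
    (if n > 0 then
       (- ((1 + q1 h powi n) * (1 + q3 \<beta> h powi n) / (2 * (1 + q2 \<beta> h powi (- n)))))
          \<bullet>\<^sub>s gen (Mode Phi n)
       + (r / 2 * (1 - q1 h powi n)) \<bullet>\<^sub>s gen (Mode PhiT n)
     else if n < 0 then
       (- 1) \<bullet>\<^sub>s gen (Mode Phi n)
       + ((1 - q3 \<beta> h powi (- n)) / (r * (1 + q2 \<beta> h powi n))) \<bullet>\<^sub>s gen (Mode PhiT n)
     else (- 1) \<bullet>\<^sub>s gen (Mode Phi 0))"

definition Q1_perp :: nser where
  "Q1_perp = gen (ZeroQ Phi)"

definition a0_perp :: "complex \<Rightarrow> nser" where
  "a0_perp r = (r / 2) \<bullet>\<^sub>s gen (Mode PhiT 0)"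

definition Q_perp :: "complex \<Rightarrow> nser" where
  "Q_perp r = r \<bullet>\<^sub>s gen (ZeroQ PhiT)"

text \<open>The factor \<open>z^X\<close> is \<open>e^(X log z)\<close>.\<close>

definition S1 :: "sgn \<Rightarrow> complex \<Rightarrow> complex \<Rightarrow> complex \<Rightarrow> complex \<Rightarrow> complex \<Rightarrow> nser" where
  "S1 e \<beta> r h z l =
     hexp (fsum {0<..} (\<lambda>n. (gamma_coeff e \<beta> h n * z powi n)
             \<bullet>\<^sub>s (h1 \<beta> r h (- n) + (s_par e \<beta> h powi n) \<bullet>\<^sub>s h2 \<beta> r h (- n))))
     \<star> hexp (fsum {0<..} (\<lambda>n. (gamma_coeff e \<beta> h n * z powi (- n))
             \<bullet>\<^sub>s ((s_par e \<beta> h powi n) \<bullet>\<^sub>s h1 \<beta> r h n + h2 \<beta> r h n)))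
     \<star> hexp (Q1_perp + tau e \<beta> \<bullet>\<^sub>s Q_perp r)
     \<star> hexp (l \<bullet>\<^sub>s (h1 \<beta> r h 0 + (2 * tau e \<beta>) \<bullet>\<^sub>s a0_perp r))"

definition S2 :: "sgn \<Rightarrow> complex \<Rightarrow> complex \<Rightarrow> complex \<Rightarrow> complex \<Rightarrow> complex \<Rightarrow> nser" where
  "S2 e \<beta> r h z l =
     hexp (fsum {0<..} (\<lambda>n. (gamma_coeff e \<beta> h n * z powi n)
             \<bullet>\<^sub>s ((s_par e \<beta> h powi n) \<bullet>\<^sub>s h1 \<beta> r h (- n) + h2 \<beta> r h (- n))))
     \<star> hexp (fsum {0<..} (\<lambda>n. (gamma_coeff e \<beta> h n * z powi (- n))
             \<bullet>\<^sub>s (h1 \<beta> r h n + (s_par e \<beta> h powi n) \<bullet>\<^sub>s h2 \<beta> r h n)))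
     \<star> hexp ((- 1) \<bullet>\<^sub>s Q1_perp + tau e \<beta> \<bullet>\<^sub>s Q_perp r)
     \<star> hexp (l \<bullet>\<^sub>s ((- 1) \<bullet>\<^sub>s h1 \<beta> r h 0 + (2 * tau e \<beta>) \<bullet>\<^sub>s a0_perp r))"

definition screening :: "sgn \<Rightarrow> complex \<Rightarrow> complex \<Rightarrow> complex \<Rightarrow> complex \<Rightarrow> complex \<Rightarrow> nser" where
  "screening e \<beta> r h z l = S1 e \<beta> r h z l - S2 e \<beta> r h z l"

end

theory Submission
  imports Defs
begin

text \<open>
  Every exponent in sight is an infinite linear combination of generators, so everything
  reduces to exponentials of linear series.

  The coefficient of a monomial \<open>m\<close> in \<open>:e^F:\<close>, for \<open>F\<close> linear with coefficients \<open>c\<close>, is the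
  finite product of \<open>c x ^ n / n!\<close> over the generators \<open>x\<close> of \<open>m\<close>, with \<open>n\<close> the multiplicity of \<open>x\<close>
  (\<open>exp_ser\<close>, \<open>nexp_linear\<close>).  It depends continuously on finitely many of the \<open>c x\<close>, and
  normally ordered multiplication of such exponentials adds the coefficients
  (\<open>nprod_exp_ser\<close>).  A product in which no annihilator on the left meets its partner on the
  right has no contractions, hence is the normally ordered one (\<open>hprod_eq_nprod\<close>).  The four
  factors of \<open>S1\<close> and \<open>S2\<close> are ordered so that this applies: oscillators with \<open>n < 0\<close>, then those
  with \<open>n > 0\<close>, then \<open>Q\<close>s, then zero modes.  It applies to \<open>psi\<close> times the
  exponential of the other boson as well, since partners belong to the same boson.
  So both sides of the limit are differences of two normally ordered exponentials, and it
  remains to compare the coefficients of the exponents.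

  This is a statement about each generator.  The zero modes do not depend on \<open>h\<close> and match
  because \<open>tau e \<beta> * r = t_par e r\<close>.  For an oscillator, write \<open>s = exp (a h)\<close>; then
  \<open>gamma_coeff\<close> has a simple pole at \<open>h = 0\<close>, with leading term
  \<open>- 1 / (n^2 a h)\<close>, and multiplies a combination of the modes of \<open>h1\<close> and
  \<open>h2\<close> which vanishes at \<open>h = 0\<close>; in mode \<open>k\<close> its derivative there is \<open>k a\<close>
  (up to the sign that distinguishes \<open>S1\<close> and \<open>S2\<close>) for the first boson, and
  \<open>- k r = t_par e r * k * a\<close> for the second.  The product tends
  to \<open>- 1 / k\<close> times that sign or \<open>t_par e r\<close>, which, up to the common factor \<open>z ^ (- k)\<close>, is the
  coefficient in the free field.
\<close>

section \<open>Linear and exponential series\<close>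

lemma gen_fun_eqI:
  assumes "\<And>n. c (Mode Phi n) = d (Mode Phi n)" "\<And>n. c (Mode PhiT n) = d (Mode PhiT n)"
    and "c (ZeroQ Phi) = d (ZeroQ Phi)" "c (ZeroQ PhiT) = d (ZeroQ PhiT)"
  shows "c = d"
proof
  fix x
  show "c x = d x"
  proof (cases x)
    case (Mode b n)
    then show ?thesis using assms by (cases b) auto
  next
    case (ZeroQ b)
    then show ?thesis using assms by (cases b) auto
  qed
qed

definition linear_ser :: "(gen \<Rightarrow> complex) \<Rightarrow> nser" where
  "linear_ser c m = (if size m = 1 then \<Prod>x\<in>#m. c x else 0)"

text \<open>
  This is \<open>:e^F:\<close> for \<open>F = linear_ser c\<close> (see \<open>nexp_linear\<close>): of the \<open>k!\<close> orderings in which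
  the \<open>k\<close>-th power produces \<open>m\<close>, those that only permute equal generators coincide.
\<close>

definition exp_ser :: "(gen \<Rightarrow> complex) \<Rightarrow> nser" where
  "exp_ser c m = (\<Prod>x\<in>set_mset m. c x ^ count m x / fact (count m x))"

lemma linear_ser_single [simp]: "linear_ser c {#x#} = c x"
  by (simp add: linear_ser_def)

lemma linear_ser_eq_0: "(\<And>x. m \<noteq> {#x#}) \<Longrightarrow> linear_ser c m = 0"
  unfolding linear_ser_def by (metis size_1_singleton_mset)

lemma nser_eqI_linear:
  assumes "\<And>x. F {#x#} = c x" and "\<And>m. (\<And>x. m \<noteq> {#x#}) \<Longrightarrow> F m = 0"
  shows "F = linear_ser c"
proof
  show "F m = linear_ser c m" for m
  proof (cases "\<exists>x. m = {#x#}")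
    case True
    then show ?thesis using assms(1) by auto
  next
    case False
    then show ?thesis using assms(2)[of m] linear_ser_eq_0[of m c] by auto
  qed
qed

lemma gen_linear: "gen x = linear_ser (\<lambda>y. if y = x then 1 else 0)"
  by (rule nser_eqI_linear) (auto simp: monom_def)

lemma scal_linear: "a \<bullet>\<^sub>s linear_ser c = linear_ser (\<lambda>x. a * c x)"
  by (rule nser_eqI_linear) (auto simp: scal_def linear_ser_eq_0)

lemma add_linear: "linear_ser c + linear_ser d = linear_ser (\<lambda>x. c x + d x)"
  by (rule nser_eqI_linear) (auto simp: linear_ser_eq_0)

lemma diff_linear: "linear_ser c - linear_ser d = linear_ser (\<lambda>x. c x - d x)"
  by (rule nser_eqI_linear) (auto simp: linear_ser_eq_0)

lemma fsum_linear: "fsum I (\<lambda>i. linear_ser (c i)) = linear_ser (\<lambda>x. \<Sum>\<^sub>\<infinity>i\<in>I. c i x)"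
  by (rule nser_eqI_linear) (auto simp: fsum_def linear_ser_eq_0)

lemmas linear_simps = gen_linear scal_linear add_linear diff_linear fsum_linear

lemma infsum_single_term:
  fixes f :: "'i \<Rightarrow> complex"
  assumes "\<And>j. j \<in> I \<Longrightarrow> j \<noteq> i \<Longrightarrow> f j = 0"
  shows "(\<Sum>\<^sub>\<infinity>j\<in>I. f j) = (if i \<in> I then f i else 0)"
proof -
  have "(\<Sum>\<^sub>\<infinity>j\<in>I. f j) = (\<Sum>\<^sub>\<infinity>j\<in>I \<inter> {i}. f j)"
    by (rule infsum_cong_neutral) (use assms in auto)
  then show ?thesis by (cases "i \<in> I") simp_all
qed

lemma exp_ser_superset:
  assumes "finite A" "set_mset m \<subseteq> A"
  shows "exp_ser c m = (\<Prod>x\<in>A. c x ^ count m x / fact (count m x))"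
  unfolding exp_ser_def using assms
  by (intro prod.mono_neutral_left) (auto simp: not_in_iff)

lemma exp_ser_empty [simp]: "exp_ser c {#} = 1"
  by (simp add: exp_ser_def)

text \<open>
  The coefficient form of \<open>\<partial>/\<partial>x e^F = c x e^F\<close>.  Together with the constant term it determines
  the exponential, so that multiplicativity can be proved by induction over the monomial.
\<close>

lemma exp_ser_add_mset:
  "of_nat (Suc (count m x)) * exp_ser c (add_mset x m) = c x * exp_ser c m"
proof -
  let ?A = "insert x (set_mset m)"
  let ?g = "\<lambda>k y. c y ^ count k y / (fact (count k y) :: complex)"
  have "exp_ser c (add_mset x m) = (\<Prod>y\<in>?A. ?g (add_mset x m) y)"
    by (rule exp_ser_superset) auto
  also have "\<dots> = ?g (add_mset x m) x * (\<Prod>y\<in>?A - {x}. ?g (add_mset x m) y)"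
    by (rule prod.remove) auto
  also have "(\<Prod>y\<in>?A - {x}. ?g (add_mset x m) y) = (\<Prod>y\<in>?A - {x}. ?g m y)"
    by (rule prod.cong) auto
  finally have 1: "exp_ser c (add_mset x m)
      = ?g (add_mset x m) x * (\<Prod>y\<in>?A - {x}. ?g m y)" .
  have "exp_ser c m = (\<Prod>y\<in>?A. ?g m y)"
    by (rule exp_ser_superset) auto
  also have "\<dots> = ?g m x * (\<Prod>y\<in>?A - {x}. ?g m y)"
    by (rule prod.remove) auto
  finally show ?thesis unfolding 1
    by (simp del: of_nat_Suc add: fact_Suc)
qed

lemma exp_ser_eq_0: "x \<in># m \<Longrightarrow> c x = 0 \<Longrightarrow> exp_ser c m = 0"
  unfolding exp_ser_def by (intro prod_zero) (auto intro!: bexI[of _ x])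

lemma tendsto_exp_ser:
  assumes "\<And>x. ((\<lambda>h. c h x) \<longlongrightarrow> d x) F"
  shows "((\<lambda>h. exp_ser (c h) m) \<longlongrightarrow> exp_ser d m) F"
  unfolding exp_ser_def by (intro tendsto_intros assms) auto

lemma nprod_linear:
  "nprod (linear_ser c) F m = (\<Sum>x\<in>set_mset m. c x * F (m - {#x#}))"
proof -
  have "nprod (linear_ser c) F m
      = (\<Sum>m1\<in>(\<lambda>x. {#x#}) ` set_mset m. linear_ser c m1 * F (m - m1))"
    unfolding nprod_def
    by (rule sum.mono_neutral_right) (auto simp: finite_submultisets intro!: linear_ser_eq_0)
  also have "\<dots> = (\<Sum>x\<in>set_mset m. c x * F (m - {#x#}))"
    by (subst sum.reindex) (auto simp: inj_on_def)
  finally show ?thesis .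
qed

text \<open>
  In the induction step the first factor picks one generator \<open>x\<close> of \<open>m\<close>, with weight
  \<open>count m x\<close>; these weights add up to \<open>size m\<close>, which turns \<open>k!\<close> into \<open>(k + 1)!\<close>.
\<close>

lemma npow_linear:
  "npow (linear_ser c) k m = (if size m = k then fact k * exp_ser c m else 0)"
proof (induction k arbitrary: m)
  case 0
  then show ?case by (auto simp: monom_def)
next
  case (Suc k)
  have step: "c x * exp_ser c (m - {#x#}) = of_nat (count m x) * exp_ser c m"
    if "x \<in># m" for x
    using exp_ser_add_mset[of "m - {#x#}" x c] that
    by (simp del: of_nat_Suc add: Suc_diff_1)
  have "npow (linear_ser c) (Suc k) m
      = (\<Sum>x\<in>set_mset m. if size m = Suc k then
            fact k * (of_nat (count m x) * exp_ser c m) else 0)"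
    unfolding npow.simps nprod_linear Suc.IH
    by (rule sum.cong) (auto simp: step[symmetric] size_Diff_singleton_if,
       metis Suc_pred nonempty_has_size set_mset_empty emptyE)
  also have "\<dots> = (if size m = Suc k then
       fact k * (of_nat (\<Sum>x\<in>set_mset m. count m x) * exp_ser c m) else 0)"
    by (simp add: sum_distrib_left sum_distrib_right)
  also have "(\<Sum>x\<in>set_mset m. count m x) = size m"
    by (simp add: size_multiset_overloaded_eq)
  finally show ?case by (simp add: algebra_simps)
qed

lemma nexp_linear: "nexp (linear_ser c) = exp_ser c"
proof
  fix m
  have "nexp (linear_ser c) m = (\<Sum>\<^sub>\<infinity>k. if k = size m then exp_ser c m else 0)"
    unfolding nexp_def fsum_def
    by (rule infsum_cong) (auto simp: scal_def npow_linear)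
  also have "\<dots> = exp_ser c m"
    by (subst infsum_single_term[where i = "size m"]) auto
  finally show "nexp (linear_ser c) m = exp_ser c m" .
qed

lemma mset_double_diff: "k \<subseteq># m \<Longrightarrow> m - (m - k) = k" for k m :: "'a multiset"
  by (metis add_diff_cancel_right' subset_mset.add_diff_inverse)

lemma nprod_commute: "nprod F G = nprod G F"
proof
  show "nprod F G m = nprod G F m" for m
    unfolding nprod_def
    by (rule sum.reindex_bij_witness[where i = "\<lambda>k. m - k" and j = "\<lambda>k. m - k"])
      (auto simp: mult.commute mset_double_diff)
qed

text \<open>
  One half of the Leibniz rule for the normally ordered product: weighting a splitting of the
  monomial by the multiplicity of \<open>x\<close> in the first part is differentiating the first factor.
\<close>

lemma sum_count_exp_ser:
  "(\<Sum>m1 | m1 \<subseteq># add_mset x m. of_nat (count m1 x) * (exp_ser c m1 * G (add_mset x m - m1)))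
     = c x * nprod (exp_ser c) G m"
proof -
  have "(\<Sum>m1 | m1 \<subseteq># add_mset x m. of_nat (count m1 x) * (exp_ser c m1 * G (add_mset x m - m1)))
     = (\<Sum>m1\<in>add_mset x ` {k. k \<subseteq># m}.
          of_nat (count m1 x) * (exp_ser c m1 * G (add_mset x m - m1)))"
  proof (rule sum.mono_neutral_right)
    have "m1 \<in> add_mset x ` {k. k \<subseteq># m}" if "m1 \<subseteq># add_mset x m" "x \<in># m1" for m1
    proof -
      obtain k where "m1 = add_mset x k" using \<open>x \<in># m1\<close> by (metis insert_DiffM)
      with \<open>m1 \<subseteq># add_mset x m\<close> show ?thesis by auto
    qed
    then show "\<forall>m1\<in>{m1. m1 \<subseteq># add_mset x m} - add_mset x ` {k. k \<subseteq># m}.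
        of_nat (count m1 x) * (exp_ser c m1 * G (add_mset x m - m1)) = 0"
      by (auto simp: not_in_iff)
  qed (auto simp: finite_submultisets)
  also have "\<dots> = (\<Sum>k | k \<subseteq># m. of_nat (Suc (count k x)) * exp_ser c (add_mset x k) * G (m - k))"
    by (subst sum.reindex) (auto simp: inj_on_def mult.assoc)
  also have "\<dots> = c x * nprod (exp_ser c) G m"
    unfolding nprod_def exp_ser_add_mset by (simp add: sum_distrib_left mult.assoc)
  finally show ?thesis .
qed

text \<open>
  By the Leibniz rule the product satisfies the same differential equation as the
  exponential of the sum.
\<close>

lemma nprod_exp_ser: "nprod (exp_ser c) (exp_ser d) = exp_ser (\<lambda>x. c x + d x)"
proof
  fix m
  show "nprod (exp_ser c) (exp_ser d) m = exp_ser (\<lambda>x. c x + d x) m"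
  proof (induction m)
    case empty
    then show ?case by (simp add: nprod_def)
  next
    case (add x m)
    let ?M = "add_mset x m"
    have "of_nat (Suc (count m x)) * nprod (exp_ser c) (exp_ser d) ?M
        = (\<Sum>m1 | m1 \<subseteq># ?M. of_nat (count m1 x) * (exp_ser c m1 * exp_ser d (?M - m1)))
        + (\<Sum>m1 | m1 \<subseteq># ?M. of_nat (count (?M - m1) x) * (exp_ser c m1 * exp_ser d (?M - m1)))"
    proof -
      have "of_nat (Suc (count m x)) = (of_nat (count m1 x) + of_nat (count (?M - m1) x) :: complex)"
        if "m1 \<subseteq># ?M" for m1
        using mset_subset_eq_count[OF that, of x]
        by (simp del: of_nat_Suc add: of_nat_add[symmetric])
      then show ?thesis
        unfolding nprod_def sum_distrib_left sum.distrib[symmetric]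
        by (intro sum.cong) (auto simp: algebra_simps)
    qed
    also have "(\<Sum>m1 | m1 \<subseteq># ?M. of_nat (count (?M - m1) x) * (exp_ser c m1 * exp_ser d (?M - m1)))
        = (\<Sum>m1 | m1 \<subseteq># ?M. of_nat (count m1 x) * (exp_ser d m1 * exp_ser c (?M - m1)))"
      by (rule sum.reindex_bij_witness[where i = "\<lambda>k. ?M - k" and j = "\<lambda>k. ?M - k"])
        (auto simp: mult.commute mset_double_diff)
    finally have "of_nat (Suc (count m x)) * nprod (exp_ser c) (exp_ser d) ?M
        = (c x + d x) * nprod (exp_ser c) (exp_ser d) m"
      unfolding sum_count_exp_ser
      by (simp add: nprod_commute[of "exp_ser d"] distrib_right)
    also have "\<dots> = of_nat (Suc (count m x)) * exp_ser (\<lambda>x. c x + d x) ?M"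
      unfolding exp_ser_add_mset add.IH ..
    finally show ?case by (simp del: of_nat_Suc)
  qed
qed

section \<open>Products without contractions\<close>

text \<open>
  A nonempty multiset of contractions contains some annihilator \<open>x\<close>; its term then involves
  a monomial of \<open>F\<close> with \<open>x\<close> and a monomial of \<open>G\<close> with the partner of \<open>x\<close>.
\<close>

lemma hprod_eq_nprod:
  assumes "\<And>x M1 M2. is_ann x \<Longrightarrow> x \<in># M1 \<Longrightarrow> partner x \<in># M2 \<Longrightarrow> F M1 = 0 \<or> G M2 = 0"
  shows "F \<star> G = nprod F G"
proof
  fix m
  let ?S = "\<lambda>k. \<Sum>m1 | m1 \<subseteq># m.
     (let M1 = m1 + k; M2 = (m - m1) + image_mset partner k
      in wick_weight k M1 M2 * F M1 * G M2)"
  have "?S k = 0" if k: "\<forall>x\<in>#k. is_ann x" "k \<noteq> {#}" for k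
  proof -
    obtain x where x: "x \<in># k" using k(2) by auto
    then have "F (m1 + k) = 0 \<or> G ((m - m1) + image_mset partner k) = 0" for m1
      using k(1) by (intro assms[of x]) auto
    then show ?thesis unfolding Let_def by (intro sum.neutral) (metis mult_zero_left mult_zero_right)
  qed
  then have "(F \<star> G) m = ?S {#}"
    unfolding hprod_def by (subst infsum_single_term[where i = "{#}"]) auto
  then show "(F \<star> G) m = nprod F G m"
    by (simp add: wick_weight_def nprod_def)
qed

lemma exp_ser_hprod:
  assumes "\<And>x. is_ann x \<Longrightarrow> c x = 0 \<or> d (partner x) = 0"
  shows "exp_ser c \<star> exp_ser d = exp_ser (\<lambda>x. c x + d x)"
proof -
  have "exp_ser c \<star> exp_ser d = nprod (exp_ser c) (exp_ser d)"
    using assms by (intro hprod_eq_nprod) (metis exp_ser_eq_0)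
  then show ?thesis by (simp add: nprod_exp_ser)
qed

lemma hexp_linear:
  assumes "\<And>x. is_ann x \<Longrightarrow> c x = 0 \<or> c (partner x) = 0"
  shows "hexp (linear_ser c) = exp_ser c"
proof -
  have "hpow (linear_ser c) k = npow (linear_ser c) k" for k
  proof (induction k)
    case (Suc k)
    have "linear_ser c M1 = 0 \<or> npow (linear_ser c) k M2 = 0"
      if "is_ann x" "x \<in># M1" "partner x \<in># M2" for x M1 M2
    proof (cases "c x = 0")
      case True
      then show ?thesis using that(2) by (auto simp: linear_ser_def)
    next
      case False
      then have "exp_ser c M2 = 0" using assms that by (metis exp_ser_eq_0)
      then show ?thesis by (simp add: npow_linear)
    qed
    then show ?case by (simp add: Suc.IH hprod_eq_nprod)
  qed simp
  then show ?thesis by (simp add: hexp_def nexp_linear[symmetric] nexp_def)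
qed

text \<open>
  The order of the factors matters: an annihilator never stands to the left of its partner.
  The positive modes precede \<open>Q\<close>, but their partners are the negative modes in \<open>u\<close>; the zero
  modes, which are the partners of the \<open>Q\<close>s, come last.
\<close>

lemma hexp_product:
  assumes u: "\<And>b n. n \<ge> 0 \<Longrightarrow> u (Mode b n) = 0" "\<And>b. u (ZeroQ b) = 0"
    and v: "\<And>b n. n \<le> 0 \<Longrightarrow> v (Mode b n) = 0" "\<And>b. v (ZeroQ b) = 0"
    and p: "\<And>b n. p (Mode b n) = 0"
    and s: "\<And>b n. n \<noteq> 0 \<Longrightarrow> s (Mode b n) = 0" "\<And>b. s (ZeroQ b) = 0"
  shows "hexp (linear_ser u) \<star> hexp (linear_ser v) \<star> hexp (linear_ser p) \<star> hexp (linear_ser s)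
    = exp_ser (\<lambda>x. u x + v x + p x + s x)"
proof -
  have *: "P x" if "is_ann x" "\<And>b n. n \<ge> 0 \<Longrightarrow> P (Mode b n)" for P x
    using that by (cases x) auto
  have "hexp (linear_ser u) = exp_ser u" "hexp (linear_ser v) = exp_ser v"
    "hexp (linear_ser p) = exp_ser p" "hexp (linear_ser s) = exp_ser s"
    by (rule hexp_linear, erule *, simp add: assms)+
  moreover have "exp_ser u \<star> exp_ser v = exp_ser (\<lambda>x. u x + v x)"
    by (rule exp_ser_hprod, erule *) (simp add: assms)
  moreover have "exp_ser (\<lambda>x. u x + v x) \<star> exp_ser p = exp_ser (\<lambda>x. u x + v x + p x)"
    by (rule exp_ser_hprod, erule *) (simp add: assms)
  moreover have "exp_ser (\<lambda>x. u x + v x + p x) \<star> exp_ser s = exp_ser (\<lambda>x. u x + v x + p x + s x)"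
    by (rule exp_ser_hprod, erule *) (simp add: assms)
  ultimately show ?thesis by simp
qed

section \<open>The super Virasoro screening current\<close>

text \<open>The coefficients of the exponent \<open>\<alpha> Phi * \<phi>(z) + \<alpha> PhiT * \<phi>'(z)\<close>,
  where \<open>\<phi>'\<close> is the field of \<open>PhiT\<close>.\<close>

fun field_coeff :: "complex \<Rightarrow> complex \<Rightarrow> (boson \<Rightarrow> complex) \<Rightarrow> gen \<Rightarrow> complex" where
  "field_coeff z l \<alpha> (ZeroQ b) = \<alpha> b"
| "field_coeff z l \<alpha> (Mode b n) = \<alpha> b * (if n = 0 then l else - (z powi (- n) / of_int n))"

lemma boson_field_linear:
  "boson_field b z l = linear_ser (field_coeff z l (\<lambda>b'. if b' = b then 1 else 0))"
  unfolding boson_field_def linear_simps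
proof (rule arg_cong[where f = linear_ser], rule ext)
  fix x
  show "(if x = ZeroQ b then 1 else 0) + l * (if x = Mode b 0 then 1 else 0)
      - (\<Sum>\<^sub>\<infinity>n\<in>-{0}. z powi (- n) / of_int n * (if x = Mode b n then 1 else 0))
     = field_coeff z l (\<lambda>b'. if b' = b then 1 else 0) x"
  proof (cases x)
    case (Mode b' k)
    then show ?thesis by (subst infsum_single_term[where i = k]) auto
  qed auto
qed

text \<open>
  A generator and its partner belong to the same boson, whereas \<open>\<psi>\<close> involves only \<open>Phi\<close> and
  the other factor only \<open>PhiT\<close>; so there are no contractions and the exponents add up.
\<close>

lemma super_screening_eq:
  assumes "w \<noteq> 0" "t \<noteq> 0"
  shows "(w / t) \<bullet>\<^sub>s super_screening w t z l
    = exp_ser (field_coeff z l (\<lambda>b. if b = Phi then 1 else t))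
    - exp_ser (field_coeff z l (\<lambda>b. if b = Phi then - 1 else t))"
proof -
  let ?E = "\<lambda>\<epsilon>. exp_ser (field_coeff z l (\<lambda>b. if b = Phi then \<epsilon> else 0))"
  let ?T = "exp_ser (field_coeff z l (\<lambda>b. if b = PhiT then t else 0))"
  have scal: "a \<bullet>\<^sub>s boson_field b z l
      = linear_ser (field_coeff z l (\<lambda>b'. if b' = b then a else 0))" for a b
    unfolding boson_field_linear scal_linear
  proof (rule arg_cong[where f = linear_ser], rule ext)
    show "a * field_coeff z l (\<lambda>b'. if b' = b then 1 else 0) x
      = field_coeff z l (\<lambda>b'. if b' = b then a else 0) x" for x by (cases x) auto
  qed
  have psi: "psi w z l = (1 / w) \<bullet>\<^sub>s (?E 1 - ?E (- 1))"
    unfolding psi_def by (simp only: scal) (simp only: boson_field_linear nexp_linear)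
  have T: "nexp (t \<bullet>\<^sub>s boson_field PhiT z l) = ?T"
    by (simp only: scal nexp_linear)
  have vanish: "?E \<epsilon> M1 = 0 \<or> ?T M2 = 0"
    if "x \<in># M1" "partner x \<in># M2" for \<epsilon> x M1 M2
  proof (cases "\<exists>n. x = Mode Phi n \<or> x = ZeroQ Phi")
    case True
    then have "field_coeff z l (\<lambda>b. if b = PhiT then t else 0) (partner x) = 0" by auto
    then show ?thesis using that by (metis exp_ser_eq_0)
  next
    case False
    then have "field_coeff z l (\<lambda>b. if b = Phi then \<epsilon> else 0) x = 0" by (cases x) auto
    then show ?thesis using that by (metis exp_ser_eq_0)
  qed
  have nE: "nprod (?E \<epsilon>) ?T = exp_ser (field_coeff z l (\<lambda>b. if b = Phi then \<epsilon> else t))" for \<epsilon>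
    unfolding nprod_exp_ser by (rule arg_cong[where f = exp_ser], rule gen_fun_eqI) auto
  have "psi w z l \<star> ?T = nprod (psi w z l) ?T"
  proof (rule hprod_eq_nprod)
    show "psi w z l M1 = 0 \<or> ?T M2 = 0" if "x \<in># M1" "partner x \<in># M2" for x M1 M2
      using vanish[OF that, of 1] vanish[OF that, of "- 1"] by (auto simp: psi scal_def)
  qed
  also have "\<dots> = (1 / w) \<bullet>\<^sub>s (nprod (?E 1) ?T - nprod (?E (- 1)) ?T)"
    unfolding psi
    by (rule ext) (simp add: nprod_def scal_def sum_subtractf[symmetric] sum_distrib_left
        left_diff_distrib sum_divide_distrib diff_divide_distrib)
  finally show ?thesis using assms unfolding super_screening_def T nE
    by (simp add: scal_def fun_eq_iff)
qed

section \<open>The deformed screening currents\<close>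

text \<open>
  The modes of \<open>h1\<close> and \<open>h2\<close> differ only by the sign of their \<open>Phi\<close> part, which is the
  parameter \<open>\<epsilon>\<close>.  Consequently \<open>S2\<close> arises from \<open>S1\<close> by replacing \<open>\<epsilon> = 1\<close> by
  \<open>\<epsilon> = - 1\<close>, and one computation covers both.
\<close>

fun h_coeff :: "complex \<Rightarrow> complex \<Rightarrow> complex \<Rightarrow> complex \<Rightarrow> int \<Rightarrow> gen \<Rightarrow> complex" where
  "h_coeff \<epsilon> \<beta> r h n (ZeroQ b) = 0"
| "h_coeff \<epsilon> \<beta> r h n (Mode Phi m) = (if m \<noteq> n then 0 else \<epsilon> *
     (if n > 0 then (1 + q1 h powi n) * (1 + q3 \<beta> h powi n) / (2 * (1 + q2 \<beta> h powi (- n)))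
      else 1))"
| "h_coeff \<epsilon> \<beta> r h n (Mode PhiT m) = (if m \<noteq> n then 0
     else if n > 0 then r / 2 * (1 - q1 h powi n)
     else if n < 0 then (1 - q3 \<beta> h powi (- n)) / (r * (1 + q2 \<beta> h powi n))
     else 0)"

lemma h_coeff_off: "m \<noteq> n \<Longrightarrow> h_coeff \<epsilon> \<beta> r h n (Mode b m) = 0"
  by (cases b) auto

lemma h1_linear: "h1 \<beta> r h n = linear_ser (h_coeff 1 \<beta> r h n)"
  by (cases n "0 :: int" rule: linorder_cases)
    (auto simp: h1_def linear_simps intro!: arg_cong[where f = linear_ser] gen_fun_eqI)

lemma h2_linear: "h2 \<beta> r h n = linear_ser (h_coeff (- 1) \<beta> r h n)"
  by (cases n "0 :: int" rule: linorder_cases)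
    (auto simp: h2_def linear_simps intro!: arg_cong[where f = linear_ser] gen_fun_eqI)

text \<open>The coefficients of the total exponent of \<open>S1\<close> (\<open>\<epsilon> = 1\<close>) and \<open>S2\<close> (\<open>\<epsilon> = - 1\<close>).\<close>

fun dressed_coeff ::
  "complex \<Rightarrow> sgn \<Rightarrow> complex \<Rightarrow> complex \<Rightarrow> complex \<Rightarrow> complex \<Rightarrow> complex \<Rightarrow> gen \<Rightarrow> complex" where
  "dressed_coeff \<epsilon> e \<beta> r z l h (ZeroQ b) = (if b = Phi then \<epsilon> else tau e \<beta> * r)"
| "dressed_coeff \<epsilon> e \<beta> r z l h (Mode b n) =
    (if n < 0 then gamma_coeff e \<beta> h (- n) * z powi (- n)
       * (h_coeff \<epsilon> \<beta> r h n (Mode b n) + s_par e \<beta> h powi (- n) * h_coeff (- \<epsilon>) \<beta> r h n (Mode b n))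
     else if n > 0 then gamma_coeff e \<beta> h n * z powi (- n)
       * (s_par e \<beta> h powi n * h_coeff \<epsilon> \<beta> r h n (Mode b n) + h_coeff (- \<epsilon>) \<beta> r h n (Mode b n))
     else if b = Phi then l * \<epsilon> else l * (2 * tau e \<beta> * (r / 2)))"

lemma dressed_exp:
  "hexp (fsum {0<..} (\<lambda>n. (gamma_coeff e \<beta> h n * z powi n)
       \<bullet>\<^sub>s (linear_ser (h_coeff \<epsilon> \<beta> r h (- n))
           + (s_par e \<beta> h powi n) \<bullet>\<^sub>s linear_ser (h_coeff (- \<epsilon>) \<beta> r h (- n)))))
   \<star> hexp (fsum {0<..} (\<lambda>n. (gamma_coeff e \<beta> h n * z powi (- n))
       \<bullet>\<^sub>s ((s_par e \<beta> h powi n) \<bullet>\<^sub>s linear_ser (h_coeff \<epsilon> \<beta> r h n)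
           + linear_ser (h_coeff (- \<epsilon>) \<beta> r h n))))
   \<star> hexp (\<epsilon> \<bullet>\<^sub>s Q1_perp + tau e \<beta> \<bullet>\<^sub>s Q_perp r)
   \<star> hexp (l \<bullet>\<^sub>s (\<epsilon> \<bullet>\<^sub>s h1 \<beta> r h 0 + (2 * tau e \<beta>) \<bullet>\<^sub>s a0_perp r))
   = exp_ser (dressed_coeff \<epsilon> e \<beta> r z l h)"
proof -
  have c1: "(\<Sum>\<^sub>\<infinity>n\<in>{0<..}. gamma_coeff e \<beta> h n * z powi n
        * (h_coeff \<epsilon> \<beta> r h (- n) x + s_par e \<beta> h powi n * h_coeff (- \<epsilon>) \<beta> r h (- n) x))
      = (case x of ZeroQ b \<Rightarrow> 0 | Mode b n \<Rightarrow> if n < 0 then dressed_coeff \<epsilon> e \<beta> r z l h x else 0)" for x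
  proof (cases x)
    case (Mode b m)
    show ?thesis unfolding Mode
      by (subst infsum_single_term[where i = "- m"]) (auto simp: h_coeff_off)
  qed simp
  have c2: "(\<Sum>\<^sub>\<infinity>n\<in>{0<..}. gamma_coeff e \<beta> h n * z powi (- n)
        * (s_par e \<beta> h powi n * h_coeff \<epsilon> \<beta> r h n x + h_coeff (- \<epsilon>) \<beta> r h n x))
      = (case x of ZeroQ b \<Rightarrow> 0 | Mode b n \<Rightarrow> if n > 0 then dressed_coeff \<epsilon> e \<beta> r z l h x else 0)" for x
  proof (cases x)
    case (Mode b m)
    show ?thesis unfolding Mode
      by (subst infsum_single_term[where i = m]) (auto simp: h_coeff_off)
  qed simp
  show ?thesis
    unfolding Q1_perp_def Q_perp_def a0_perp_def h1_def
    by (simp only: less_irrefl if_False linear_simps c1 c2, subst hexp_product)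
      (auto intro!: arg_cong[where f = exp_ser] gen_fun_eqI)
qed

lemma S1_eq: "S1 e \<beta> r h z l = exp_ser (dressed_coeff 1 e \<beta> r z l h)"
proof -
  have "1 \<bullet>\<^sub>s F = F" for F by (simp add: scal_def)
  then show ?thesis
    unfolding dressed_exp[symmetric] S1_def h1_linear h2_linear by simp
qed

lemma S2_eq: "S2 e \<beta> r h z l = exp_ser (dressed_coeff (- 1) e \<beta> r z l h)"
  unfolding dressed_exp[symmetric] S2_def h1_linear h2_linear by (simp add: add.commute)

section \<open>The limit\<close>

text \<open>The number \<open>a\<close> with \<open>s_par e \<beta> h = exp (a * h)\<close>.\<close>

fun s_exponent :: "sgn \<Rightarrow> complex \<Rightarrow> complex" where
  "s_exponent Plus \<beta> = - \<beta>"
| "s_exponent Minus \<beta> = 1"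

lemma exp_powi_tendsto:
  fixes c :: complex
  shows "((\<lambda>h. exp (c * h) powi n) \<longlongrightarrow> 1) (at 0)"
  unfolding exp_power_int by (auto intro!: tendsto_eq_intros)

lemma one_minus_exp_powi_tendsto:
  fixes c :: complex
  shows "((\<lambda>h. (1 - exp (c * h) powi n) / h) \<longlongrightarrow> - (of_int n * c)) (at 0)"
proof -
  have "((\<lambda>h. 1 - exp (of_int n * (c * h))) has_field_derivative - (of_int n * c)) (at 0)"
    by (auto intro!: derivative_eq_intros)
  then show ?thesis
    unfolding exp_power_int by (simp add: has_field_derivative_iff)
qed

lemma s_par_exp: "s_par e \<beta> h = exp (s_exponent e \<beta> * h)"
  by (cases e) (auto simp: q1_def q3_def)

lemma s_half_exp: "s_half e \<beta> h = exp (s_exponent e \<beta> / 2 * h)"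
  by (cases e) auto

text \<open>
  The simple pole of \<open>gamma_coeff\<close> comes from \<open>1 - s ^ (2 n)\<close>, which behaves like
  \<open>- 2 n a h\<close>; all other factors have finite nonzero limits.  In the limit it therefore
  reads off the derivative \<open>x\<close> at \<open>0\<close> of the function it multiplies.
\<close>

lemma gamma_coeff_tendsto:
  fixes X :: "complex \<Rightarrow> complex"
  assumes n: "n > 0" and a: "s_exponent e \<beta> \<noteq> 0"
    and X: "((\<lambda>h. X h / h) \<longlongrightarrow> x) (at 0)"
  shows "((\<lambda>h. gamma_coeff e \<beta> h n * X h) \<longlongrightarrow> - (x / (of_int n ^ 2 * s_exponent e \<beta>))) (at 0)"
proof -
  let ?a = "s_exponent e \<beta>"
  let ?g = "\<lambda>h. exp (?a / 2 * h) powi n * (1 + exp ((\<beta> - 1) * h) powi n)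
     / (of_int n * exp ((\<beta> - 1) / 2 * h) powi n * ((1 - exp (?a * h) powi (2 * n)) / h)) * (X h / h)"
  have "(?g \<longlongrightarrow> 1 * (1 + 1) / (of_int n * 1 * - (of_int (2 * n) * ?a)) * x) (at 0)"
    using n a by (intro tendsto_intros exp_powi_tendsto one_minus_exp_powi_tendsto X) auto
  also have "1 * (1 + 1) / (of_int n * 1 * - (of_int (2 * n) * ?a)) * x
      = - (x / (of_int n ^ 2 * ?a))"
    using n a by (simp add: field_simps power2_eq_square)
  finally have "(?g \<longlongrightarrow> - (x / (of_int n ^ 2 * ?a))) (at 0)" .
  moreover have "\<forall>\<^sub>F h in at 0. ?g h = gamma_coeff e \<beta> h n * X h"
    using eventually_neq_at_within[of 0]
    by eventually_elim
      (simp add: gamma_coeff_def s_par_exp s_half_exp q0_def q2_def divide_simps)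
  ultimately show ?thesis by (rule Lim_transform_eventually)
qed

lemma t_par_eq_tau:
  assumes "\<beta> \<noteq> 0" and "r ^ 2 = \<beta>"
  shows "tau e \<beta> * r = t_par e r"
  using assms by (cases e) (auto simp: power2_eq_square field_simps)

text \<open>
  The combinations multiplied by \<open>gamma_coeff\<close> vanish at \<open>h = 0\<close> for two reasons: for \<open>Phi\<close> the
  two modes enter with opposite signs and leave \<open>1 - s ^ n\<close>, for \<open>PhiT\<close> each mode already
  contains \<open>1 - q3 ^ n\<close> or \<open>1 - q1 ^ n\<close>.  Their derivatives have the common form
  \<open>\<alpha> * k * a\<close> for creation and annihilation modes \<open>k\<close>; for \<open>PhiT\<close> this uses that
  \<open>t_par e r * a = - r\<close> for both signs.
\<close>

lemma dressed_coeff_tendsto: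
  assumes b: "\<beta> \<noteq> 0" and r: "r ^ 2 = \<beta>"
  shows "((\<lambda>h. dressed_coeff \<epsilon> e \<beta> r z l h x) \<longlongrightarrow>
    field_coeff z l (\<lambda>b. if b = Phi then \<epsilon> else t_par e r) x) (at 0)"
proof -
  let ?a = "s_exponent e \<beta>" and ?t = "t_par e r" and ?s = "\<lambda>h. s_par e \<beta> h"
  let ?\<alpha> = "\<lambda>b. if b = Phi then \<epsilon> else ?t"
  have a: "?a \<noteq> 0" using b by (cases e) auto
  have r0: "r \<noteq> 0" using b r by auto
  have ta: "?t * ?a = - r" using r0 r by (cases e) (auto simp: power2_eq_square)
  have q1: "q1 h = exp (1 * h)" for h by (simp add: q1_def)
  note exps = q1 q2_def q3_def s_par_exp
  note lims = tendsto_intros exp_powi_tendsto one_minus_exp_powi_tendsto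
  have creation: "((\<lambda>h. (h_coeff \<epsilon> \<beta> r h k (Mode c k)
        + ?s h powi (- k) * h_coeff (- \<epsilon>) \<beta> r h k (Mode c k)) / h)
      \<longlongrightarrow> ?\<alpha> c * of_int k * ?a) (at 0)" if k: "k < 0" for k c
  proof (cases c)
    case Phi
    have "((\<lambda>h. \<epsilon> * ((1 - ?s h powi (- k)) / h)) \<longlongrightarrow> \<epsilon> * - (of_int (- k) * ?a)) (at 0)"
      unfolding exps by (intro lims)
    then show ?thesis using k Phi by (simp add: algebra_simps)
  next
    case PhiT
    have "((\<lambda>h. (1 + ?s h powi (- k)) * ((1 - q3 \<beta> h powi (- k)) / h)
          / (r * (1 + q2 \<beta> h powi k)))
        \<longlongrightarrow> (1 + 1) * - (of_int (- k) * (- \<beta>)) / (r * (1 + 1))) (at 0)"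
      unfolding exps using r0 by (intro lims) auto
    also have "(1 + 1) * - (of_int (- k) * (- \<beta>)) / (r * (1 + 1)) = ?t * ?a * of_int k"
      unfolding ta using r0 r[symmetric] by (simp add: field_simps power2_eq_square)
    finally have lim: "((\<lambda>h. (1 + ?s h powi (- k)) * ((1 - q3 \<beta> h powi (- k)) / h)
          / (r * (1 + q2 \<beta> h powi k))) \<longlongrightarrow> ?t * ?a * of_int k) (at 0)" .
    have "(1 + p) * (u / h) / d = (u / d + p * (u / d)) / h" for p u d h :: complex
      unfolding distrib_right add_divide_distrib by (simp add: mult.commute)
    with lim show ?thesis using k PhiT by (simp add: mult_ac)
  qed
  have annihilation: "((\<lambda>h. (?s h powi k * h_coeff \<epsilon> \<beta> r h k (Mode c k)
        + h_coeff (- \<epsilon>) \<beta> r h k (Mode c k)) / h)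
      \<longlongrightarrow> ?\<alpha> c * of_int k * ?a) (at 0)" if k: "k > 0" for k c
  proof (cases c)
    case Phi
    define A where
      "A h = (1 + q1 h powi k) * (1 + q3 \<beta> h powi k) / (2 * (1 + q2 \<beta> h powi (- k)))" for h
    have coeff: "h_coeff \<delta> \<beta> r h k (Mode c k) = \<delta> * A h" for \<delta> h
      using k Phi by (simp add: A_def)
    have "((\<lambda>h. - \<epsilon> * ((1 - ?s h powi k) / h) * A h)
        \<longlongrightarrow> - \<epsilon> * - (of_int k * ?a) * ((1 + 1) * (1 + 1) / (2 * (1 + 1)))) (at 0)"
      unfolding A_def exps by (intro lims) auto
    moreover have "- \<epsilon> * ((1 - ?s h powi k) / h) * A h
        = (?s h powi k * (\<epsilon> * A h) + - \<epsilon> * A h) / h" for h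
      by (simp add: divide_inverse algebra_simps)
    ultimately show ?thesis unfolding coeff using Phi by (simp add: mult.assoc)
  next
    case PhiT
    have "((\<lambda>h. (1 + ?s h powi k) * (r / 2 * ((1 - q1 h powi k) / h)))
        \<longlongrightarrow> (1 + 1) * (r / 2 * - (of_int k * 1))) (at 0)"
      unfolding exps by (intro lims) auto
    also have "(1 + 1) * (r / 2 * - (of_int k * 1)) = ?t * ?a * of_int k"
      unfolding ta by simp
    finally have "((\<lambda>h. (1 + ?s h powi k) * (r / 2 * ((1 - q1 h powi k) / h)))
        \<longlongrightarrow> ?t * ?a * of_int k) (at 0)" .
    moreover have "(1 + p) * (y * (u / h)) = (p * (y * u) + y * u) / h" for p y u h :: complex
      by (simp add: divide_inverse algebra_simps)
    ultimately have "((\<lambda>h. (?s h powi k * (r / 2 * (1 - q1 h powi k)) + r / 2 * (1 - q1 h powi k)) / h)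
        \<longlongrightarrow> ?t * ?a * of_int k) (at 0)"
      by (simp only:)
    then show ?thesis using k PhiT by (simp add: mult_ac)
  qed
  show ?thesis
  proof (cases x)
    case (ZeroQ c)
    then show ?thesis using t_par_eq_tau[OF b r, of e] by simp
  next
    case (Mode c k)
    consider "k < 0" | "k = 0" | "k > 0" by linarith
    then show ?thesis
    proof cases
      case 1
      have "((\<lambda>h. z powi (- k) * (gamma_coeff e \<beta> h (- k) * (h_coeff \<epsilon> \<beta> r h k (Mode c k)
          + ?s h powi (- k) * h_coeff (- \<epsilon>) \<beta> r h k (Mode c k))))
        \<longlongrightarrow> z powi (- k) * - (?\<alpha> c * of_int k * ?a / (of_int (- k) ^ 2 * ?a))) (at 0)"
        using 1 a by (intro tendsto_mult tendsto_const gamma_coeff_tendsto creation) auto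
      also have "z powi (- k) * - (?\<alpha> c * of_int k * ?a / (of_int (- k) ^ 2 * ?a))
          = field_coeff z l ?\<alpha> x"
        using 1 a Mode by (simp add: power2_eq_square)
      finally show ?thesis using 1 Mode by (simp add: mult_ac)
    next
      case 2
      then show ?thesis using Mode t_par_eq_tau[OF b r, of e] by (simp add: mult_ac)
    next
      case 3
      have "((\<lambda>h. z powi (- k) * (gamma_coeff e \<beta> h k * (?s h powi k * h_coeff \<epsilon> \<beta> r h k (Mode c k)
          + h_coeff (- \<epsilon>) \<beta> r h k (Mode c k))))
        \<longlongrightarrow> z powi (- k) * - (?\<alpha> c * of_int k * ?a / (of_int k ^ 2 * ?a))) (at 0)"
        using 3 a by (intro tendsto_mult tendsto_const gamma_coeff_tendsto annihilation) auto
      also have "z powi (- k) * - (?\<alpha> c * of_int k * ?a / (of_int k ^ 2 * ?a))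
          = field_coeff z l ?\<alpha> x"
        using 3 a Mode by (simp add: power2_eq_square)
      finally show ?thesis using 3 Mode by (simp add: mult_ac)
    qed
  qed
qed

theorem theorem4p3:
  fixes \<beta> r w z l :: complex
  assumes "\<beta> \<noteq> 0" and "r ^ 2 = \<beta>" and "w ^ 2 = - 2" and "exp l = z"
  shows "(\<exists>\<rho>. \<rho> ^ 2 = (sigma_par \<beta> r) ^ 2 + 1 \<and>
            t_par Plus r = sigma_par \<beta> r + \<rho> \<and> t_par Minus r = sigma_par \<beta> r - \<rho>) \<and>
         (\<forall>e. \<forall>m. ((\<lambda>h. screening e \<beta> r h z l m) \<longlongrightarrow>
            ((w / t_par e r) \<bullet>\<^sub>s super_screening w (t_par e r) z l) m) (at 0))"
proof (intro conjI allI)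
  have r: "r \<noteq> 0" using assms by auto
  have w: "w \<noteq> 0" using assms by auto
  show "\<exists>\<rho>. \<rho> ^ 2 = (sigma_par \<beta> r) ^ 2 + 1 \<and>
            t_par Plus r = sigma_par \<beta> r + \<rho> \<and> t_par Minus r = sigma_par \<beta> r - \<rho>"
    using r unfolding assms(2)[symmetric]
    \<comment> \<open>Half the difference of the two parameters \<open>1 / r\<close> and \<open>- r\<close>.\<close>
    by (intro exI[of _ "(1 + r ^ 2) / (2 * r)"])
      (simp add: sigma_par_def field_simps power2_eq_square)
  fix e m
  have t: "t_par e r \<noteq> 0" using r by (cases e) auto
  show "((\<lambda>h. screening e \<beta> r h z l m) \<longlongrightarrow>
            ((w / t_par e r) \<bullet>\<^sub>s super_screening w (t_par e r) z l) m) (at 0)"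
    unfolding super_screening_eq[OF w t] screening_def S1_eq S2_eq fun_diff_def
    using assms by (intro tendsto_diff tendsto_exp_ser dressed_coeff_tendsto)
qed

end
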